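(* $\mathrm{QSym}$ is rigid as a Hopf algebra with respect to the monomial basis: if $\varphi:\mathrm{QSym}\to\mathrm{QSym}$ is a graded Hopf algebra automorphism with $\varphi(\{M_\alpha:\alpha\in\mathcal{C}\})=\{M_\alpha:\alpha\in\mathcal{C}\}$, then $\varphi$ is the identity map.
   Context: A composition is a finite (possibly empty) ordered list $\alpha=(\alpha_1,\dots,\alpha_k)$ of positive integers; $|\alpha|=\alpha_1+\cdots+\alpha_k$, and $\mathcal{C}$ is the set of all compositions ($\emptyset$ is the empty one). $\mathrm{QSym}$ is the set of bounded-degree formal power series $f\in\mathbb{Q}[[x_1,x_2,\dots]]$ such that for each composition $(\alpha_1,\dots,\alpha_k)$ all monomials $x_{i_1}^{\alpha_1}\cdots x_{i_k}^{\alpha_k}$ with $i_1<\cdots<i_k$ have the same coefficient in $f$. The monomial basis of $\mathrm{QSym}$ consists of $M_\emptyset=1$ and $M_\alpha=\sum_{i_1<\cdots<i_k}x_{i_1}^{\alpha_1}\cdots x_{i_k}^{\alpha_k}$ for nonempty $\alpha=(\alpha_1,\dots,\alpha_k)$. $\mathrm{QSym}=\bigoplus_{n\ge0}\mathrm{QSym}_n$ is a connected graded Hopf algebra over $\mathbb{Q}$, where $\mathrm{QSym}_n=\mathrm{span}\{M_\alpha:|\alpha|=n\}$, the product is the product of power series, the coproduct is $\Delta(M_\alpha)=\sum_{\alpha=\beta\cdot\gamma}M_\beta\otimes M_\gamma$ (sum over all ways, empty compositions allowed, of writing $\alpha$ as a concatenation $\beta\cdot\gamma$), and the counit satisfies $\varepsilon(M_\emptyset)=1$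 and $\varepsilon(M_\alpha)=0$ for $\alpha\ne\emptyset$. A map is graded if it maps $\mathrm{QSym}_n$ into $\mathrm{QSym}_n$ for all $n$. *)

theory Defs
  imports Complex_Main "HOL-Library.Poly_Mapping"
begin

abbreviation "lookup \<equiv> Poly_Mapping.lookup"
abbreviation "keys \<equiv> Poly_Mapping.keys"

section \<open>Rational vector spaces\<close>

class rat_vector = ab_group_add +
  fixes scaleQ :: "rat \<Rightarrow> 'a \<Rightarrow> 'a"  (infixr \<open>*\<^sub>Q\<close> 75)
  assumes scaleQ_add_right: "c *\<^sub>Q (x + y) = c *\<^sub>Q x + c *\<^sub>Q y"
    and scaleQ_add_left: "(c + d) *\<^sub>Q x = c *\<^sub>Q x + d *\<^sub>Q x"
    and scaleQ_scaleQ: "c *\<^sub>Q d *\<^sub>Q x = (c * d) *\<^sub>Q x"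
    and scaleQ_one: "1 *\<^sub>Q x = x"

global_interpretation rat_vs: vector_space "scaleQ :: rat \<Rightarrow> 'a \<Rightarrow> 'a::rat_vector"
  by standard (rule scaleQ_add_right scaleQ_add_left scaleQ_scaleQ scaleQ_one)+

abbreviation rat_linear :: "('a::rat_vector \<Rightarrow> 'b::rat_vector) \<Rightarrow> bool" where
  "rat_linear \<equiv> Vector_Spaces.linear scaleQ scaleQ"

lemma rat_linearI:
  assumes "\<And>x y. f (x + y) = f x + f y" "\<And>c x. f (c *\<^sub>Q x) = c *\<^sub>Q f x"
  shows "rat_linear f"
  unfolding Vector_Spaces.linear_def module_hom_def module_hom_axioms_def
  by (intro conjI allI rat_vs.vector_space_axioms rat_vs.module_axioms assms)

lemma rat_linearD:
  assumes "rat_linear f"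
  shows "f (x + y) = f x + f y" "f (c *\<^sub>Q x) = c *\<^sub>Q f x"
  using assms unfolding Vector_Spaces.linear_def module_hom_def module_hom_axioms_def by auto

instantiation rat :: rat_vector
begin
definition "scaleQ_rat = ((*) :: rat \<Rightarrow> rat \<Rightarrow> rat)"
instance by standard (auto simp: scaleQ_rat_def algebra_simps)
end

instantiation poly_mapping :: (type, rat_vector) rat_vector
begin
definition "scaleQ_poly_mapping c p = Poly_Mapping.map (scaleQ c) p"

lemma lookup_scaleQ: "lookup (c *\<^sub>Q p) k = c *\<^sub>Q lookup p k"
  by (cases "lookup p k = 0") (auto simp: scaleQ_poly_mapping_def Poly_Mapping.map.rep_eq when_def)

instance
  by standard (auto simp: poly_mapping_eq_iff fun_eq_iff lookup_scaleQ lookup_add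
      scaleQ_add_right scaleQ_add_left scaleQ_scaleQ)
end


section \<open>The tensor product of two rational vector spaces\<close>

text \<open>The free vector space on all pairs, modulo the subspace forcing bilinearity.\<close>

definition tensor_relators :: "(('a::rat_vector \<times> 'b::rat_vector) \<Rightarrow>\<^sub>0 rat) set" where
  "tensor_relators =
     {Poly_Mapping.single (a + a', b) 1 - Poly_Mapping.single (a, b) 1
        - Poly_Mapping.single (a', b) 1 | a a' b. True} \<union>
     {Poly_Mapping.single (a, b + b') 1 - Poly_Mapping.single (a, b) 1
        - Poly_Mapping.single (a, b') 1 | a b b'. True} \<union>
     {Poly_Mapping.single (c *\<^sub>Q a, b) 1 - c *\<^sub>Q Poly_Mapping.single (a, b) 1 | c a b. True} \<union>
     {Poly_Mapping.single (a, c *\<^sub>Q b) 1 - c *\<^sub>Q Poly_Mapping.single (a, b) 1 | c a b. True}"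

definition tensor_rel ::
  "(('a::rat_vector \<times> 'b::rat_vector) \<Rightarrow>\<^sub>0 rat) \<Rightarrow> (('a \<times> 'b) \<Rightarrow>\<^sub>0 rat) \<Rightarrow> bool" where
  "tensor_rel p q \<longleftrightarrow> p - q \<in> rat_vs.span tensor_relators"

quotient_type (overloaded) ('a, 'b) tensor = "('a::rat_vector \<times> 'b::rat_vector) \<Rightarrow>\<^sub>0 rat" / tensor_rel
proof (rule equivpI)
  show "reflp tensor_rel"
    by (auto simp: reflp_def tensor_rel_def rat_vs.span_zero)
  show "symp tensor_rel"
    by (auto simp: symp_def tensor_rel_def dest: rat_vs.span_neg)
  show "transp tensor_rel"
    by (auto simp: transp_def tensor_rel_def dest: rat_vs.span_add)
qed

instantiation tensor :: (rat_vector, rat_vector) rat_vector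
begin

lift_definition zero_tensor :: "('a, 'b) tensor" is 0 .

lift_definition plus_tensor :: "('a, 'b) tensor \<Rightarrow> ('a, 'b) tensor \<Rightarrow> ('a, 'b) tensor" is "(+)"
  unfolding tensor_rel_def by (drule (1) rat_vs.span_add) (simp add: algebra_simps)

lift_definition minus_tensor :: "('a, 'b) tensor \<Rightarrow> ('a, 'b) tensor \<Rightarrow> ('a, 'b) tensor" is "(-)"
  unfolding tensor_rel_def by (drule (1) rat_vs.span_diff) (simp add: algebra_simps)

lift_definition uminus_tensor :: "('a, 'b) tensor \<Rightarrow> ('a, 'b) tensor" is uminus
  unfolding tensor_rel_def by (drule rat_vs.span_neg) (simp add: algebra_simps)

lift_definition scaleQ_tensor :: "rat \<Rightarrow> ('a, 'b) tensor \<Rightarrow> ('a, 'b) tensor" is scaleQ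
  subgoal for c p q
    using rat_vs.span_scale[of "p - q" tensor_relators c]
    by (simp add: tensor_rel_def rat_vs.scale_right_diff_distrib)
  done

lemma tensor_rel_refl: "tensor_rel p p"
  by (simp add: tensor_rel_def rat_vs.span_zero)

lemma tensor_rel_eq: "p = q \<Longrightarrow> tensor_rel p q"
  by (simp add: tensor_rel_refl)

instance
  by standard (transfer, rule tensor_rel_eq, simp add: algebra_simps scaleQ_add_right
      scaleQ_add_left scaleQ_scaleQ)+

end

lift_definition pure_tensor :: "'a::rat_vector \<Rightarrow> 'b::rat_vector \<Rightarrow> ('a, 'b) tensor"
    (infixl \<open>\<otimes>\<close> 70)
  is "\<lambda>a b. Poly_Mapping.single (a, b) 1" .

lemma pure_tensor_bilinear:
  "(a + a') \<otimes> b = a \<otimes> b + a' \<otimes> b"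
  "a \<otimes> (b + b') = a \<otimes> b + a \<otimes> b'"
  "(c *\<^sub>Q a) \<otimes> b = c *\<^sub>Q (a \<otimes> b)"
  "a \<otimes> (c *\<^sub>Q b) = c *\<^sub>Q (a \<otimes> b)"
  by (transfer, unfold tensor_rel_def diff_diff_eq[symmetric], rule rat_vs.span_base,
      unfold tensor_relators_def, blast)+

definition free_extend :: "('a \<Rightarrow> 'b::rat_vector) \<Rightarrow> ('a \<Rightarrow>\<^sub>0 rat) \<Rightarrow> 'b" where
  "free_extend h p = (\<Sum>k\<in>keys p. lookup p k *\<^sub>Q h k)"

lemma free_extend_superset:
  assumes "finite S" "keys p \<subseteq> S"
  shows "free_extend h p = (\<Sum>k\<in>S. lookup p k *\<^sub>Q h k)"
  unfolding free_extend_def using assms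
  by (intro sum.mono_neutral_left) (auto simp: in_keys_iff)

lemma free_extend_linear: "rat_linear (free_extend h)"
proof (rule rat_linearI)
  fix p q :: "'a \<Rightarrow>\<^sub>0 rat" and c :: rat
  show "free_extend h (p + q) = free_extend h p + free_extend h q"
    unfolding free_extend_def by (rule setsum_keys_plus_distrib) (simp_all add: scaleQ_add_left)
  have "keys (c *\<^sub>Q p) \<subseteq> keys p"
    by (auto simp: in_keys_iff lookup_scaleQ scaleQ_rat_def)
  then show "free_extend h (c *\<^sub>Q p) = c *\<^sub>Q free_extend h p"
    by (subst free_extend_superset[of "keys p"])
      (simp_all add: free_extend_def lookup_scaleQ scaleQ_rat_def rat_vs.scale_sum_right)
qed

lemma free_extend_single: "free_extend h (Poly_Mapping.single k c) = c *\<^sub>Q h k"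
  by (simp add: free_extend_def)

text \<open>
  The map \<open>f \<otimes> g\<close> induced on tensors.  It is meant for linear \<open>f\<close> and \<open>g\<close>; then the
  result does not depend on the representative chosen by \<^const>\<open>rep_tensor\<close>, as the
  characterisation after it shows.
\<close>

definition tensor_map ::
  "('a::rat_vector \<Rightarrow> 'c::rat_vector) \<Rightarrow> ('b::rat_vector \<Rightarrow> 'd::rat_vector) \<Rightarrow>
   ('a, 'b) tensor \<Rightarrow> ('c, 'd) tensor" where
  "tensor_map f g t = free_extend (\<lambda>(a, b). f a \<otimes> g b) (rep_tensor t)"

lemma free_extend_tensor_rel:
  fixes f :: "'a::rat_vector \<Rightarrow> 'c::rat_vector" and g :: "'b::rat_vector \<Rightarrow> 'd::rat_vector"
  assumes f: "rat_linear f" and g: "rat_linear g" and "tensor_rel p q"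
  shows "free_extend (\<lambda>(a, b). f a \<otimes> g b) p = free_extend (\<lambda>(a, b). f a \<otimes> g b) q"
proof -
  let ?F = "free_extend (\<lambda>(a, b). f a \<otimes> g b)"
  interpret F: Vector_Spaces.linear scaleQ scaleQ ?F by (rule free_extend_linear)
  have "?F r = 0" if "r \<in> tensor_relators" for r
    using that unfolding tensor_relators_def
    by (auto simp: F.diff F.scale free_extend_single scaleQ_one pure_tensor_bilinear
        rat_linearD[OF f] rat_linearD[OF g])
  then have "?F r = 0" if "r \<in> rat_vs.span tensor_relators" for r
    using F.eq_0_on_span that by blast
  then have "?F (p - q) = 0"
    using assms(3) by (simp add: tensor_rel_def)
  then show ?thesis by (simp add: F.diff)
qed

lemma tensor_map_abs:
  assumes "rat_linear f" "rat_linear g"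
  shows "tensor_map f g (abs_tensor p) = free_extend (\<lambda>(a, b). f a \<otimes> g b) p"
  unfolding tensor_map_def
  by (rule free_extend_tensor_rel[OF assms Quotient_rep_abs[OF Quotient_tensor tensor_rel_refl]])

lemma tensor_map_pure:
  assumes "rat_linear f" "rat_linear g"
  shows "tensor_map f g (a \<otimes> b) = f a \<otimes> g b"
  by (simp add: pure_tensor.abs_eq tensor_map_abs[OF assms] free_extend_single scaleQ_one)

lemma tensor_map_linear:
  assumes "rat_linear f" "rat_linear g"
  shows "rat_linear (tensor_map f g)"
proof (rule rat_linearI)
  fix x y :: "('a, 'c) tensor" and c :: rat
  obtain p q where xy: "x = abs_tensor p" "y = abs_tensor q"
    by (metis Quotient_abs_rep[OF Quotient_tensor])
  show "tensor_map f g (x + y) = tensor_map f g x + tensor_map f g y"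
    unfolding xy plus_tensor.abs_eq tensor_map_abs[OF assms]
    by (rule rat_linearD[OF free_extend_linear])
  show "tensor_map f g (c *\<^sub>Q x) = c *\<^sub>Q tensor_map f g x"
    unfolding xy scaleQ_tensor.abs_eq tensor_map_abs[OF assms]
    by (rule rat_linearD[OF free_extend_linear])
qed


section \<open>Compositions\<close>

typedef composition = "{xs :: nat list. \<forall>x\<in>set xs. 0 < x}"
  morphisms parts Composition
  by (rule exI[of _ "[]"]) simp

setup_lifting type_definition_composition

lift_definition comp_empty :: composition is "[]" by simp

lift_definition comp_size :: "composition \<Rightarrow> nat" is sum_list .

lift_definition comp_concat :: "composition \<Rightarrow> composition \<Rightarrow> composition"  (infixr \<open>\<cdot>\<close> 65)
  is "(@)" by auto


section \<open>Quasisymmetric functions\<close>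

text \<open>
  A power series is given by its coefficients.  The variables are indexed by \<^typ>\<open>nat\<close>
  starting from 0, and a monomial is its finitely supported exponent function.
\<close>

type_synonym monomial = "nat \<Rightarrow>\<^sub>0 nat"
type_synonym power_series = "monomial \<Rightarrow> rat"

definition mdegree :: "monomial \<Rightarrow> nat" where
  "mdegree m = (\<Sum>i\<in>keys m. lookup m i)"

text \<open>The monomial with exponents \<open>es\<close> at the variables \<open>is\<close>.\<close>

definition monomial_at :: "nat list \<Rightarrow> nat list \<Rightarrow> monomial" where
  "monomial_at is es = (\<Sum>(i, e)\<leftarrow>zip is es. Poly_Mapping.single i e)"

definition bounded_degree :: "power_series \<Rightarrow> bool" where
  "bounded_degree f \<longleftrightarrow> (\<exists>d. \<forall>m. f m \<noteq> 0 \<longrightarrow> mdegree m \<le> d)"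

definition quasisymmetric :: "power_series \<Rightarrow> bool" where
  "quasisymmetric f \<longleftrightarrow>
     (\<forall>\<alpha> is js. sorted_wrt (<) is \<and> length is = length (parts \<alpha>) \<and>
                sorted_wrt (<) js \<and> length js = length (parts \<alpha>) \<longrightarrow>
        f (monomial_at is (parts \<alpha>)) = f (monomial_at js (parts \<alpha>)))"

definition ps_mult :: "power_series \<Rightarrow> power_series \<Rightarrow> power_series" where
  "ps_mult f g m = (\<Sum>(a, b) | a + b = m. f a * g b)"

lemma finite_compositions_le: "finite {\<alpha>. comp_size \<alpha> \<le> n}"
proof -
  have len: "length xs \<le> sum_list xs" if "\<forall>x\<in>set xs. 0 < x" for xs :: "nat list"
    using that by (induction xs) auto
  have "parts ` {\<alpha>. comp_size \<alpha> \<le> n} \<subseteq> {xs. set xs \<subseteq> {..n} \<and> length xs \<le> n}"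
  proof (rule image_subsetI)
    fix \<alpha> assume "\<alpha> \<in> {\<alpha>. comp_size \<alpha> \<le> n}"
    then have "sum_list (parts \<alpha>) \<le> n" by (simp add: comp_size.rep_eq)
    moreover have "length (parts \<alpha>) \<le> sum_list (parts \<alpha>)"
      using len parts by blast
    moreover have "x \<le> sum_list (parts \<alpha>)" if "x \<in> set (parts \<alpha>)" for x
      using that by (simp add: member_le_sum_list)
    ultimately show "parts \<alpha> \<in> {xs. set xs \<subseteq> {..n} \<and> length xs \<le> n}"
      by (auto intro: order_trans)
  qed
  then have "finite (parts ` {\<alpha>. comp_size \<alpha> \<le> n})"
    by (rule finite_subset) (rule finite_lists_length_le, simp)
  then show ?thesis
    by (rule finite_imageD) (simp add: inj_on_def parts_inject)
qed

lemma monomial_at_Nil [simp]: "monomial_at [] es = 0" "monomial_at is [] = 0"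
  by (simp_all add: monomial_at_def)

lemma monomial_at_Cons [simp]:
  "monomial_at (i # is) (e # es) = Poly_Mapping.single i e + monomial_at is es"
  by (simp add: monomial_at_def)

lemma lookup_monomial_at_notin: "i \<notin> set is \<Longrightarrow> lookup (monomial_at is es) i = 0"
  by (induction "is" es rule: list_induct2') (auto simp: lookup_add lookup_single)

lemma keys_monomial_at_subset: "keys (monomial_at is es) \<subseteq> set is"
  using lookup_monomial_at_notin by (metis in_keys_iff subsetI)

lemma lookup_monomial_at:
  "distinct is \<Longrightarrow> length is = length es \<Longrightarrow> map (lookup (monomial_at is es)) is = es"
proof (induction "is" es rule: list_induct2')
  case (4 i "is" e es)
  have "map (lookup (monomial_at (i # is) (e # es))) is = map (lookup (monomial_at is es)) is"
    using 4 by (intro map_cong[OF refl]) (auto simp: lookup_add lookup_single when_def)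
  with 4 show ?case by (simp add: lookup_add[of _ _ i] lookup_monomial_at_notin)
qed auto

lemma monomial_at_lookup:
  assumes "distinct is" "keys m \<subseteq> set is"
  shows "monomial_at is (map (lookup m) is) = m"
proof (rule poly_mapping_eqI)
  fix i
  show "lookup (monomial_at is (map (lookup m) is)) i = lookup m i"
  proof (cases "i \<in> set is")
    case True
    then show ?thesis
      using lookup_monomial_at[of "is" "map (lookup m) is"] assms(1) by auto
  next
    case False
    with assms(2) have "lookup m i = 0" by (auto simp: in_keys_iff)
    with False show ?thesis by (simp add: lookup_monomial_at_notin)
  qed
qed

lemma keys_monomial_at:
  assumes "distinct is" "length is = length es" "\<forall>x\<in>set es. 0 < x"
  shows "keys (monomial_at is es) = set is"
proof -
  have "lookup (monomial_at is es) i > 0" if "i \<in> set is" for i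
  proof -
    have "lookup (monomial_at is es) i \<in> set (map (lookup (monomial_at is es)) is)"
      using that by simp
    then show ?thesis
      using assms(3) by (simp only: lookup_monomial_at[OF assms(1,2)])
  qed
  then show ?thesis
    using lookup_monomial_at_notin[of _ "is" es] by (force simp: in_keys_iff)
qed

lemma mdegree_monomial_at:
  assumes "distinct is" "length is = length es"
  shows "mdegree (monomial_at is es) = sum_list es"
proof -
  have "mdegree (monomial_at is es) = (\<Sum>i\<in>set is. lookup (monomial_at is es) i)"
    unfolding mdegree_def
    by (rule sum.mono_neutral_left) (simp_all add: keys_monomial_at_subset in_keys_iff)
  also have "\<dots> = sum_list (map (lookup (monomial_at is es)) is)"
    using assms(1) by (simp add: sum_list_distinct_conv_sum_set)
  finally show ?thesis by (simp add: lookup_monomial_at[OF assms])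
qed

lemma mdegree_add: "mdegree (a + b) = mdegree a + mdegree b"
  unfolding mdegree_def by (rule setsum_keys_plus_distrib) simp_all

lemma monomial_at_eq_iff:
  assumes "sorted_wrt (<) is" "length is = length (parts \<alpha>)"
    and "sorted_wrt (<) js" "length js = length (parts \<beta>)"
  shows "monomial_at is (parts \<alpha>) = monomial_at js (parts \<beta>) \<longleftrightarrow> is = js \<and> \<alpha> = \<beta>"
proof
  assume eq: "monomial_at is (parts \<alpha>) = monomial_at js (parts \<beta>)"
  have d: "distinct is" "distinct js"
    using assms(1,3) by (simp_all add: strict_sorted_iff)
  have "set is = set js"
    using eq keys_monomial_at[OF d(1) assms(2)] keys_monomial_at[OF d(2) assms(4)] parts
    by (metis (mono_tags, lifting) mem_Collect_eq)
  then have ij: "is = js"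
    using assms(1,3) by (simp add: strict_sorted_equal)
  then have "parts \<alpha> = parts \<beta>"
    using lookup_monomial_at[OF d(1) assms(2)] lookup_monomial_at[OF d(2) assms(4)] eq by metis
  with ij show "is = js \<and> \<alpha> = \<beta>" by (simp add: parts_inject)
qed simp

lemma monomial_at_ex_iff:
  assumes "sorted_wrt (<) is" "length is = length (parts \<beta>)"
  shows "(\<exists>js. sorted_wrt (<) js \<and> length js = length (parts \<alpha>) \<and>
             monomial_at is (parts \<beta>) = monomial_at js (parts \<alpha>)) \<longleftrightarrow> \<alpha> = \<beta>"
  using monomial_at_eq_iff[OF assms] assms by metis

lemma monomial_at_cases:
  obtains "is" \<alpha> where "sorted_wrt (<) is" "length is = length (parts \<alpha>)"
    "m = monomial_at is (parts \<alpha>)"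
proof -
  let ?is = "sorted_list_of_set (keys m)"
  let ?\<alpha> = "Composition (map (lookup m) ?is)"
  have p: "parts ?\<alpha> = map (lookup m) ?is"
    by (rule Composition_inverse) (auto simp: in_keys_iff)
  show thesis
    by (rule that[of ?is ?\<alpha>]) (simp_all add: p monomial_at_lookup)
qed

lemma quasisymmetricD:
  assumes "quasisymmetric f" "sorted_wrt (<) is" "length is = length (parts \<alpha>)"
    and "sorted_wrt (<) js" "length js = length (parts \<alpha>)"
  shows "f (monomial_at is (parts \<alpha>)) = f (monomial_at js (parts \<alpha>))"
  using assms unfolding quasisymmetric_def by blast

text \<open>Quasisymmetry also applies to exponent vectors containing zeros.\<close>

lemma quasisymmetric_zeros:
  assumes f: "quasisymmetric f"
    and "sorted_wrt (<) is" "length is = length es"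
    and "sorted_wrt (<) js" "length js = length es"
  shows "f (monomial_at is es) = f (monomial_at js es)"
proof -
  let ?drop = "\<lambda>is. map fst (filter (\<lambda>(i, e). 0 < e) (zip is es))"
  let ?\<alpha> = "Composition (filter (\<lambda>e. 0 < e) es)"
  have p: "parts ?\<alpha> = filter (\<lambda>e. 0 < e) es"
    by (rule Composition_inverse) auto
  have drop: "monomial_at is es = monomial_at (?drop is) (parts ?\<alpha>) \<and>
      sorted_wrt (<) (?drop is) \<and> length (?drop is) = length (parts ?\<alpha>)"
    if "sorted_wrt (<) is" "length is = length es" for "is"
    unfolding p using that(2,1)
  proof (induction "is" es rule: list_induct2)
    case (Cons i "is" e es)
    have "set (map fst (filter (\<lambda>(i, e). 0 < e) (zip is es))) \<subseteq> set is"
      by (auto dest: set_zip_leftD)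
    with Cons show ?case by (auto simp: subset_iff)
  qed simp
  show ?thesis
    using f drop[OF assms(2,3)] drop[OF assms(4,5)] unfolding quasisymmetric_def by metis
qed

lemma finite_splittings: "finite {(a, b). a + b = (m :: monomial)}"
proof -
  have le: "lookup m i \<le> mdegree m" for i
    unfolding mdegree_def by (cases "i \<in> keys m") (auto simp: in_keys_iff intro: member_le_sum)
  let ?F = "{h :: nat \<Rightarrow> nat. \<forall>i. (i \<in> keys m \<longrightarrow> h i \<in> {..mdegree m}) \<and> (i \<notin> keys m \<longrightarrow> h i = 0)}"
  have mem: "lookup a \<in> ?F" if "a + b = m" for a b
  proof -
    have "lookup a i \<le> lookup m i" for i
      using that by (auto simp: lookup_add)
    then show ?thesis
      using le by (auto simp: in_keys_iff intro: order_trans) (metis le_zero_eq)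
  qed
  have "lookup ` {a. \<exists>b. a + b = m} \<subseteq> ?F"
  proof (rule image_subsetI)
    fix a assume "a \<in> {a. \<exists>b. a + b = m}"
    then obtain b where "a + b = m" by blast
    then show "lookup a \<in> ?F" by (rule mem)
  qed
  moreover have "finite ?F" by (rule finite_set_of_finite_funs) auto
  ultimately have "finite (lookup ` {a. \<exists>b. a + b = m})" by (rule finite_subset)
  then have "finite {a. \<exists>b. a + b = m}"
    by (rule finite_imageD) (simp add: inj_on_def lookup_inject)
  moreover have "{(a, b). a + b = m} \<subseteq> (\<lambda>a. (a, m - a)) ` {a. \<exists>b. a + b = m}"
    by (auto simp: image_iff)
  ultimately show ?thesis by (meson finite_imageI finite_subset)
qed

lemma ps_mult_monomial_at:
  fixes "is" es :: "nat list"
  assumes "distinct is" "length is = length es"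
  shows "ps_mult f g (monomial_at is es) =
    (\<Sum>(us, vs) | length us = length es \<and> length vs = length es \<and> map2 (+) us vs = es.
       f (monomial_at is us) * g (monomial_at is vs))"
proof -
  have add: "monomial_at is (map2 (+) us vs) = monomial_at is us + monomial_at is vs"
    if "length is = length us" "length us = length vs" for us vs :: "nat list"
    using that
    by (induction "is" us vs rule: list_induct3) (simp_all add: single_add ac_simps)
  have sub: "keys a \<subseteq> set is" "keys b \<subseteq> set is" if "a + b = monomial_at is es" for a b
    using that lookup_monomial_at_notin[of _ "is" es]
    by (metis add_is_0 in_keys_iff lookup_add subsetI)+
  show ?thesis
    unfolding ps_mult_def
  proof (rule sum.reindex_bij_witness[where
        i = "\<lambda>(us, vs). (monomial_at is us, monomial_at is vs)" and
        j = "\<lambda>(a, b). (map (lookup a) is, map (lookup b) is)"], goal_cases)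
    case (2 x)
    obtain a b where x: "x = (a, b)" by force
    have "map2 (+) (map (lookup a) is) (map (lookup b) is) = map (lookup (a + b)) is"
      by (simp add: map2_map_map lookup_add)
    also have "\<dots> = es" using 2 x lookup_monomial_at[OF assms] by simp
    finally show ?case using x assms by simp
  next
    case (1 x)
    then show ?case
      using sub assms(1) by (auto simp: monomial_at_lookup)
  next
    case (3 y)
    obtain us vs where y: "y = (us, vs)" by force
    with 3 assms(2) have "length is = length us" "length is = length vs" by auto
    with y show ?case by (simp add: lookup_monomial_at[OF assms(1)])
  next
    case (4 y)
    obtain us vs where y: "y = (us, vs)" by force
    with 4 assms(2) add[of us vs] show ?case by simp
  next
    case (5 x)
    then show ?case
      using sub assms(1) by (auto simp: monomial_at_lookup)
  qed
qed

lemma ps_mult_bounded_degree: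
  assumes "bounded_degree f" "bounded_degree g"
  shows "bounded_degree (ps_mult f g)"
proof -
  obtain d e where d: "\<And>m. f m \<noteq> 0 \<Longrightarrow> mdegree m \<le> d" and e: "\<And>m. g m \<noteq> 0 \<Longrightarrow> mdegree m \<le> e"
    using assms unfolding bounded_degree_def by metis
  have "mdegree m \<le> d + e" if "ps_mult f g m \<noteq> 0" for m
  proof -
    from that obtain a b where "a + b = m" "f a * g b \<noteq> 0"
      unfolding ps_mult_def by (auto elim!: sum.not_neutral_contains_not_neutral)
    then show ?thesis using d[of a] e[of b] by (auto simp: mdegree_add)
  qed
  then show ?thesis unfolding bounded_degree_def by blast
qed

lemma ps_mult_quasisymmetric:
  assumes "quasisymmetric f" "quasisymmetric g"
  shows "quasisymmetric (ps_mult f g)"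
  unfolding quasisymmetric_def
proof safe
  fix \<alpha> and "is" js :: "nat list"
  assume s: "sorted_wrt (<) is" "length is = length (parts \<alpha>)"
    "sorted_wrt (<) js" "length js = length (parts \<alpha>)"
  show "ps_mult f g (monomial_at is (parts \<alpha>)) = ps_mult f g (monomial_at js (parts \<alpha>))"
    using s quasisymmetric_zeros[OF assms(1) s(1) _ s(3)] quasisymmetric_zeros[OF assms(2) s(1) _ s(3)]
    by (auto simp: ps_mult_monomial_at strict_sorted_iff intro!: sum.cong)
qed

lemma ps_mult_assoc: "ps_mult (ps_mult f g) h = ps_mult f (ps_mult g h)"
proof
  fix m
  let ?S = "\<lambda>m :: monomial. {(a, b). a + b = m}"
  have "ps_mult (ps_mult f g) h m = (\<Sum>x\<in>?S m. \<Sum>y\<in>?S (fst x). f (fst y) * g (snd y) * h (snd x))"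
    by (simp add: ps_mult_def sum_distrib_right case_prod_unfold)
  also have "\<dots> = (\<Sum>(x, y)\<in>Sigma (?S m) (\<lambda>x. ?S (fst x)). f (fst y) * g (snd y) * h (snd x))"
    by (rule sum.Sigma) (auto simp: finite_splittings)
  also have "\<dots> = (\<Sum>(x, y)\<in>Sigma (?S m) (\<lambda>x. ?S (snd x)). f (fst x) * (g (fst y) * h (snd y)))"
    by (rule sum.reindex_bij_witness[where
        i = "\<lambda>((a, q), (b, c)). ((a + b, c), (a, b))" and
        j = "\<lambda>((p, c), (a, b)). ((a, b + c), (b, c))"])
      (auto simp: algebra_simps)
  also have "\<dots> = (\<Sum>x\<in>?S m. \<Sum>y\<in>?S (snd x). f (fst x) * (g (fst y) * h (snd y)))"
    by (rule sum.Sigma[symmetric]) (auto simp: finite_splittings)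
  also have "\<dots> = ps_mult f (ps_mult g h) m"
    by (simp add: ps_mult_def sum_distrib_left case_prod_unfold)
  finally show "ps_mult (ps_mult f g) h m = ps_mult f (ps_mult g h) m" .
qed

lemma ps_mult_commute: "ps_mult f g = ps_mult g f"
  unfolding ps_mult_def
  by (rule ext, rule sum.reindex_bij_witness[where i = prod.swap and j = prod.swap])
    (auto simp: algebra_simps)

lemma ps_mult_one: "ps_mult (\<lambda>m. of_bool (m = 0)) f = f"
proof
  fix m
  have "ps_mult (\<lambda>m. of_bool (m = 0)) f m = (\<Sum>(a, b)\<in>{(0 :: monomial, m)}. of_bool (a = 0) * f b)"
    unfolding ps_mult_def by (rule sum.mono_neutral_right) (auto simp: finite_splittings)
  then show "ps_mult (\<lambda>m. of_bool (m = 0)) f m = f m" by simp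
qed

typedef qsym = "{f. bounded_degree f \<and> quasisymmetric f}"
  morphisms coefficient Qsym
  by (rule exI[of _ "\<lambda>_. 0"]) (simp add: bounded_degree_def quasisymmetric_def)

setup_lifting type_definition_qsym

lemma bounded_degree_add:
  assumes "bounded_degree f" "bounded_degree g"
  shows "bounded_degree (\<lambda>m. f m + g m)"
proof -
  obtain d e where d: "\<And>m. f m \<noteq> 0 \<Longrightarrow> mdegree m \<le> d" and e: "\<And>m. g m \<noteq> 0 \<Longrightarrow> mdegree m \<le> e"
    using assms unfolding bounded_degree_def by metis
  have "mdegree m \<le> max d e" if "f m + g m \<noteq> 0" for m
    using d[of m] e[of m] that by (cases "f m = 0"; cases "g m = 0") auto
  then show ?thesis unfolding bounded_degree_def by blast
qed

lemma quasisymmetric_pointwise: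
  assumes "quasisymmetric f" "quasisymmetric g"
  shows "quasisymmetric (\<lambda>m. h (f m) (g m))"
  unfolding quasisymmetric_def
  by (intro allI impI arg_cong2[where f = h]) (blast intro: quasisymmetricD assms)+

lemma bounded_degree_scale: "bounded_degree f \<Longrightarrow> bounded_degree (\<lambda>m. c * f m)"
  unfolding bounded_degree_def by auto

lemma quasisymmetric_one: "quasisymmetric (\<lambda>m. of_bool (m = 0))"
  unfolding quasisymmetric_def
proof safe
  fix \<alpha> and "is" js :: "nat list"
  assume s: "sorted_wrt (<) is" "length is = length (parts \<alpha>)"
    "sorted_wrt (<) js" "length js = length (parts \<alpha>)"
  have "monomial_at ks (parts \<alpha>) = 0 \<longleftrightarrow> parts \<alpha> = []"
    if "sorted_wrt (<) ks" "length ks = length (parts \<alpha>)" for ks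
    using monomial_at_eq_iff[OF that, of "[]" comp_empty] parts_inject[of \<alpha> comp_empty] that(2)
    by (auto simp: comp_empty.rep_eq)
  then show "of_bool (monomial_at is (parts \<alpha>) = 0) = of_bool (monomial_at js (parts \<alpha>) = 0)"
    using s by simp
qed

instantiation qsym :: comm_ring_1
begin

lift_definition zero_qsym :: qsym is "\<lambda>_. 0"
  by (simp add: bounded_degree_def quasisymmetric_def)

lift_definition one_qsym :: qsym is "\<lambda>m. of_bool (m = 0)"
  using quasisymmetric_one by (auto simp: bounded_degree_def)

lift_definition plus_qsym :: "qsym \<Rightarrow> qsym \<Rightarrow> qsym" is "\<lambda>f g m. f m + g m"
  by (simp add: bounded_degree_add quasisymmetric_pointwise)

lift_definition uminus_qsym :: "qsym \<Rightarrow> qsym" is "\<lambda>f m. - f m"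
  by (simp add: bounded_degree_def quasisymmetric_def)

lift_definition minus_qsym :: "qsym \<Rightarrow> qsym \<Rightarrow> qsym" is "\<lambda>f g m. f m - g m"
  subgoal for f g
    using bounded_degree_add[of f "\<lambda>m. - 1 * g m"] bounded_degree_scale[of g "- 1"]
    by (simp add: quasisymmetric_pointwise)
  done

lift_definition times_qsym :: "qsym \<Rightarrow> qsym \<Rightarrow> qsym" is ps_mult
  by (simp add: ps_mult_bounded_degree ps_mult_quasisymmetric)

instance
proof
  fix a b c :: qsym
  show "a * b * c = a * (b * c)" by transfer (rule ps_mult_assoc)
  show "a * b = b * a" by transfer (rule ps_mult_commute)
  show "1 * a = a" by transfer (rule ps_mult_one)
  show "(a + b) * c = a * c + b * c"
    by transfer (auto simp: ps_mult_def fun_eq_iff sum.distrib[symmetric] algebra_simps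
        intro!: sum.cong)
  show "a + b + c = a + (b + c)" by transfer (simp add: algebra_simps)
  show "a + b = b + a" by transfer (simp add: algebra_simps)
  show "0 + a = a" by transfer simp
  show "- a + a = 0" by transfer simp
  show "a - b = a + - b" by transfer simp
  show "(0 :: qsym) \<noteq> 1" by transfer (auto simp: fun_eq_iff)
qed

end

instantiation qsym :: rat_vector
begin

lift_definition scaleQ_qsym :: "rat \<Rightarrow> qsym \<Rightarrow> qsym" is "\<lambda>c f m. c * f m"
  by (simp add: bounded_degree_scale quasisymmetric_def)

instance by standard (transfer, simp add: fun_eq_iff algebra_simps)+

end


section \<open>The monomial basis\<close>

text \<open>
  The parts of \<open>\<alpha>\<close> are positive, so distinct index lists \<open>is\<close> give distinct monomials and
  all coefficients of the sum defining \<open>M \<alpha>\<close> are 0 or 1.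
\<close>

lift_definition M :: "composition \<Rightarrow> qsym" is
  "\<lambda>\<alpha> m. of_bool (\<exists>is. sorted_wrt (<) is \<and> length is = length (parts \<alpha>) \<and>
                       m = monomial_at is (parts \<alpha>))"
proof safe
  fix \<alpha>
  let ?M = "\<lambda>m. of_bool (\<exists>is. sorted_wrt (<) is \<and> length is = length (parts \<alpha>) \<and>
                       m = monomial_at is (parts \<alpha>)) :: rat"
  show "bounded_degree ?M"
    unfolding bounded_degree_def
    by (rule exI[of _ "comp_size \<alpha>"])
      (auto simp: comp_size.rep_eq mdegree_monomial_at strict_sorted_iff)
  have "?M (monomial_at is (parts \<beta>)) = of_bool (\<alpha> = \<beta>)"
    if "sorted_wrt (<) is" "length is = length (parts \<beta>)" for "is" \<beta>
    by (simp only: monomial_at_ex_iff[OF that])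
  then show "quasisymmetric ?M"
    unfolding quasisymmetric_def by auto
qed

text \<open>
  The coefficient of \<open>M \<alpha>\<close> in the monomial expansion of \<open>f\<close>; by quasisymmetry any
  strictly increasing list of variables could be used to read it off.
\<close>

definition M_coeff :: "qsym \<Rightarrow> composition \<Rightarrow> rat" where
  "M_coeff f \<alpha> = coefficient f (monomial_at [0..<length (parts \<alpha>)] (parts \<alpha>))"

text \<open>The linear map sending each \<open>M \<alpha>\<close> to \<open>g \<alpha>\<close>.\<close>

definition M_extend :: "(composition \<Rightarrow> 'a::rat_vector) \<Rightarrow> qsym \<Rightarrow> 'a" where
  "M_extend g f = (\<Sum>\<alpha> | M_coeff f \<alpha> \<noteq> 0. M_coeff f \<alpha> *\<^sub>Q g \<alpha>)"

lemma M_coeff_add: "M_coeff (f + g) \<alpha> = M_coeff f \<alpha> + M_coeff g \<alpha>"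
  by (simp add: M_coeff_def plus_qsym.rep_eq)

lemma M_coeff_scaleQ: "M_coeff (c *\<^sub>Q f) \<alpha> = c * M_coeff f \<alpha>"
  by (simp add: M_coeff_def scaleQ_qsym.rep_eq)

lemma M_coeff_M: "M_coeff (M \<alpha>) \<beta> = of_bool (\<alpha> = \<beta>)"
  unfolding M_coeff_def M.rep_eq by (subst monomial_at_ex_iff) simp_all

lemma finite_M_coeff: "finite {\<alpha>. M_coeff f \<alpha> \<noteq> 0}"
proof -
  obtain d where d: "\<And>m. coefficient f m \<noteq> 0 \<Longrightarrow> mdegree m \<le> d"
    using coefficient[of f] unfolding bounded_degree_def by auto
  have "{\<alpha>. M_coeff f \<alpha> \<noteq> 0} \<subseteq> {\<alpha>. comp_size \<alpha> \<le> d}"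
    using d by (force simp: M_coeff_def comp_size.rep_eq mdegree_monomial_at)
  then show ?thesis by (rule finite_subset) (rule finite_compositions_le)
qed

lemma M_extend_superset:
  assumes "finite S" "{\<alpha>. M_coeff f \<alpha> \<noteq> 0} \<subseteq> S"
  shows "M_extend g f = (\<Sum>\<alpha>\<in>S. M_coeff f \<alpha> *\<^sub>Q g \<alpha>)"
  unfolding M_extend_def using assms by (intro sum.mono_neutral_left) auto

lemma M_extend_linear: "rat_linear (M_extend g)"
proof (rule rat_linearI)
  fix f f' :: qsym and c :: rat
  let ?S = "{\<alpha>. M_coeff f \<alpha> \<noteq> 0} \<union> {\<alpha>. M_coeff f' \<alpha> \<noteq> 0}"
  have fin: "finite ?S" by (simp add: finite_M_coeff)
  have "{\<alpha>. M_coeff (f + f') \<alpha> \<noteq> 0} \<subseteq> ?S" by (auto simp: M_coeff_add)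
  then show "M_extend g (f + f') = M_extend g f + M_extend g f'"
    using M_extend_superset[OF fin, of "f + f'" g] M_extend_superset[OF fin, of f g]
      M_extend_superset[OF fin, of f' g]
    by (simp add: M_coeff_add scaleQ_add_left sum.distrib)
  have "{\<alpha>. M_coeff (c *\<^sub>Q f) \<alpha> \<noteq> 0} \<subseteq> ?S" by (auto simp: M_coeff_scaleQ)
  then show "M_extend g (c *\<^sub>Q f) = c *\<^sub>Q M_extend g f"
    using M_extend_superset[OF fin, of "c *\<^sub>Q f" g] M_extend_superset[OF fin, of f g]
    by (simp add: M_coeff_scaleQ rat_vs.scale_sum_right)
qed

lemma M_extend_M: "M_extend g (M \<alpha>) = g \<alpha>"
proof -
  have "{\<beta>. M_coeff (M \<alpha>) \<beta> \<noteq> 0} = {\<alpha>}" by (auto simp: M_coeff_M)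
  then show ?thesis by (simp add: M_extend_def M_coeff_M)
qed

lemma M_expansion: "f = (\<Sum>\<alpha> | M_coeff f \<alpha> \<noteq> 0. M_coeff f \<alpha> *\<^sub>Q M \<alpha>)"
proof -
  have co: "coefficient (\<Sum>x\<in>A. h x) m = (\<Sum>x\<in>A. coefficient (h x) m)"
    if "finite A" for A :: "composition set" and h m
    using that by (induction A) (simp_all add: zero_qsym.rep_eq plus_qsym.rep_eq)
  have "coefficient f m = coefficient (M_extend M f) m" for m
  proof -
    obtain "is" \<beta> where m: "sorted_wrt (<) is" "length is = length (parts \<beta>)"
      "m = monomial_at is (parts \<beta>)"
      by (rule monomial_at_cases[of m])
    have q: "coefficient g m = M_coeff g \<beta>" for g
    proof -
      have "quasisymmetric (coefficient g)" using coefficient[of g] by simp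
      then show ?thesis
        unfolding M_coeff_def m(3) by (rule quasisymmetricD) (simp_all add: m(1,2))
    qed
    have "coefficient (M_extend M f) m = (\<Sum>\<alpha> | M_coeff f \<alpha> \<noteq> 0. M_coeff f \<alpha> * of_bool (\<alpha> = \<beta>))"
      unfolding M_extend_def co[OF finite_M_coeff] scaleQ_qsym.rep_eq
      by (simp only: q M_coeff_M)
    also have "\<dots> = M_coeff f \<beta>"
      using finite_M_coeff[of f] by (simp add: of_bool_def sum.delta if_distrib cong: if_cong)
    finally show ?thesis by (simp add: q)
  qed
  then have "f = M_extend M f"
    by (intro coefficient_inject[THEN iffD1] ext)
  then show ?thesis unfolding M_extend_def .
qed

lemma M_comp_empty: "M comp_empty = 1"
  by transfer (auto simp: comp_empty.rep_eq fun_eq_iff)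


section \<open>The graded Hopf algebra of quasisymmetric functions\<close>

definition qsym_homogeneous :: "nat \<Rightarrow> qsym set" where
  "qsym_homogeneous n = rat_vs.span {M \<alpha> | \<alpha>. comp_size \<alpha> = n}"

definition coproduct :: "qsym \<Rightarrow> (qsym, qsym) tensor" where
  "coproduct = M_extend (\<lambda>\<alpha>. \<Sum>(\<beta>, \<gamma>) | \<alpha> = \<beta> \<cdot> \<gamma>. M \<beta> \<otimes> M \<gamma>)"

definition counit :: "qsym \<Rightarrow> rat" where
  "counit = M_extend (\<lambda>\<alpha>. if \<alpha> = comp_empty then 1 else 0)"

lemma coproduct_M: "coproduct (M \<alpha>) = (\<Sum>(\<beta>, \<gamma>) | \<alpha> = \<beta> \<cdot> \<gamma>. M \<beta> \<otimes> M \<gamma>)"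
  by (simp add: coproduct_def M_extend_M)

text \<open>The sum in \<^const>\<open>coproduct\<close> is finite.\<close>

lemma finite_deconcatenations: "finite {(\<beta>, \<gamma>). \<alpha> = \<beta> \<cdot> \<gamma>}"
proof (rule finite_subset)
  show "{(\<beta>, \<gamma>). \<alpha> = \<beta> \<cdot> \<gamma>} \<subseteq> {\<beta>. comp_size \<beta> \<le> comp_size \<alpha>} \<times> {\<gamma>. comp_size \<gamma> \<le> comp_size \<alpha>}"
    by (auto simp: comp_size.rep_eq comp_concat.rep_eq)
qed (simp add: finite_compositions_le)

text \<open>
  A morphism of Hopf algebras is a morphism of the underlying bialgebras; compatibility with
  the antipodes is then automatic.  So is the fact that the inverse of a bijective graded
  morphism is again a graded morphism (the homogeneous components have finite dimension).
\<close>

definition hopf_hom :: "(qsym \<Rightarrow> qsym) \<Rightarrow> bool" where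
  "hopf_hom \<phi> \<longleftrightarrow>
     rat_linear \<phi> \<and>
     \<phi> 1 = 1 \<and> (\<forall>f g. \<phi> (f * g) = \<phi> f * \<phi> g) \<and>
     (\<forall>f. counit (\<phi> f) = counit f) \<and>
     (\<forall>f. coproduct (\<phi> f) = tensor_map \<phi> \<phi> (coproduct f))"

definition graded_map :: "(qsym \<Rightarrow> qsym) \<Rightarrow> bool" where
  "graded_map \<phi> \<longleftrightarrow> (\<forall>n. \<phi> ` qsym_homogeneous n \<subseteq> qsym_homogeneous n)"

definition graded_hopf_automorphism :: "(qsym \<Rightarrow> qsym) \<Rightarrow> bool" where
  "graded_hopf_automorphism \<phi> \<longleftrightarrow> hopf_hom \<phi> \<and> graded_map \<phi> \<and> bij \<phi>"

end

theory Submission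
  imports Defs
begin

text \<open>
  A linear map that permutes the monomial basis is determined by the permutation \<open>\<sigma>\<close> of
  compositions with \<open>\<phi> (M \<alpha>) = M (\<sigma> \<alpha>)\<close>.  The coproduct of \<open>M \<alpha>\<close> is the sum of the basis
  tensors \<open>M \<beta> \<otimes> M \<gamma>\<close> with \<open>\<alpha> = \<beta> \<cdot> \<gamma>\<close>, each with coefficient 1, so comparing coefficients in
  \<open>\<Delta> \<circ> \<phi> = (\<phi> \<otimes> \<phi>) \<circ> \<Delta>\<close> gives \<open>\<sigma> \<alpha> = \<sigma> \<beta> \<cdot> \<sigma> \<gamma> \<longleftrightarrow> \<alpha> = \<beta> \<cdot> \<gamma>\<close>: the permutation is an
  automorphism of the free monoid of compositions under concatenation
  (\<open>basis_permutation_concat_iff\<close>).  Such an automorphism permutes the indecomposable elements,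
  which are the one-part compositions.  There is only one of these in each size, and
  \<open>\<sigma>\<close> preserves the size because \<open>\<phi>\<close> is graded.  Hence \<open>\<sigma>\<close> fixes the generators of the monoid,
  and therefore everything (\<open>size_preserving_concat_automorphism\<close>).

  Comparing coefficients needs the basis tensors to be linearly independent.  This is seen by
  constructing the functionals dual to them, from the universal property of the tensor product.
\<close>

section \<open>Linear maps out of a tensor product\<close>

definition tensor_lift ::
  "('a::rat_vector \<Rightarrow> 'b::rat_vector \<Rightarrow> 'c::rat_vector) \<Rightarrow> ('a, 'b) tensor \<Rightarrow> 'c" where
  "tensor_lift B t = free_extend (\<lambda>(a, b). B a b) (rep_tensor t)"

text \<open>
  For bilinear \<open>B\<close> the free extension vanishes on the relators, so the representative
  chosen in \<open>tensor_lift\<close> does not matter.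
\<close>

lemma tensor_lift_abs:
  assumes "\<And>b. rat_linear (\<lambda>a. B a b)" "\<And>a. rat_linear (B a)"
  shows "tensor_lift B (abs_tensor p) = free_extend (\<lambda>(a, b). B a b) p"
proof -
  let ?F = "free_extend (\<lambda>(a, b). B a b)"
  interpret F: Vector_Spaces.linear scaleQ scaleQ ?F by (rule free_extend_linear)
  have "?F r = 0" if "r \<in> tensor_relators" for r
    using that unfolding tensor_relators_def
    by (auto simp: F.diff F.scale free_extend_single scaleQ_one
        rat_linearD[OF assms(1)] rat_linearD[OF assms(2)])
  moreover have "tensor_rel (rep_tensor (abs_tensor p)) p"
    by (rule Quotient_rep_abs[OF Quotient_tensor tensor_rel_refl])
  ultimately have "?F (rep_tensor (abs_tensor p) - p) = 0"
    unfolding tensor_rel_def using F.eq_0_on_span by blast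
  then show ?thesis by (simp add: tensor_lift_def F.diff)
qed

lemma tensor_lift_pure:
  assumes "\<And>b. rat_linear (\<lambda>a. B a b)" "\<And>a. rat_linear (B a)"
  shows "tensor_lift B (a \<otimes> b) = B a b"
  by (simp add: pure_tensor.abs_eq tensor_lift_abs[OF assms] free_extend_single scaleQ_one)

lemma tensor_lift_linear:
  fixes B :: "'a::rat_vector \<Rightarrow> 'b::rat_vector \<Rightarrow> 'c::rat_vector"
  assumes "\<And>b. rat_linear (\<lambda>a. B a b)" "\<And>a. rat_linear (B a)"
  shows "rat_linear (tensor_lift B)"
proof (rule rat_linearI)
  fix x y :: "('a, 'b) tensor" and c :: rat
  obtain p q where xy: "x = abs_tensor p" "y = abs_tensor q"
    by (metis Quotient_abs_rep[OF Quotient_tensor])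
  show "tensor_lift B (x + y) = tensor_lift B x + tensor_lift B y"
    unfolding xy plus_tensor.abs_eq tensor_lift_abs[OF assms]
    by (rule rat_linearD[OF free_extend_linear])
  show "tensor_lift B (c *\<^sub>Q x) = c *\<^sub>Q tensor_lift B x"
    unfolding xy scaleQ_tensor.abs_eq tensor_lift_abs[OF assms]
    by (rule rat_linearD[OF free_extend_linear])
qed

lemma rat_linear_sum:
  assumes "rat_linear f"
  shows "f (\<Sum>x\<in>A. h x) = (\<Sum>x\<in>A. f (h x))"
proof -
  interpret Vector_Spaces.linear scaleQ scaleQ f by (rule assms)
  show ?thesis by (rule sum)
qed


section \<open>Coefficients with respect to the basis tensors\<close>

definition tensor_coeff :: "composition \<Rightarrow> composition \<Rightarrow> (qsym, qsym) tensor \<Rightarrow> rat" where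
  "tensor_coeff \<beta> \<gamma> = tensor_lift (\<lambda>f g. M_coeff f \<beta> * M_coeff g \<gamma>)"

lemma M_coeff_product_bilinear:
  "rat_linear (\<lambda>f. M_coeff f \<beta> * M_coeff g \<gamma>)" "rat_linear (\<lambda>g. M_coeff f \<beta> * M_coeff g \<gamma>)"
  by (rule rat_linearI; simp add: M_coeff_add M_coeff_scaleQ scaleQ_rat_def algebra_simps)+

lemma tensor_coeff_linear: "rat_linear (tensor_coeff \<beta> \<gamma>)"
  unfolding tensor_coeff_def by (intro tensor_lift_linear M_coeff_product_bilinear)

lemma tensor_coeff_M:
  "tensor_coeff \<beta> \<gamma> (M \<beta>' \<otimes> M \<gamma>') = of_bool (\<beta>' = \<beta> \<and> \<gamma>' = \<gamma>)"
  unfolding tensor_coeff_def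
  by (subst tensor_lift_pure[OF M_coeff_product_bilinear]) (simp add: M_coeff_M)

text \<open>
  The terms are indexed through \<open>p\<close> because \<open>\<phi> \<otimes> \<phi>\<close> keeps the terms of a coproduct but
  relabels the basis tensors in them.
\<close>

lemma tensor_coeff_sum_M:
  assumes "finite S" "\<And>y. p y = (\<beta>, \<gamma>) \<longleftrightarrow> y = x"
  shows "tensor_coeff \<beta> \<gamma> (\<Sum>y\<in>S. M (fst (p y)) \<otimes> M (snd (p y))) = of_bool (x \<in> S)"
proof -
  have "tensor_coeff \<beta> \<gamma> (M (fst (p y)) \<otimes> M (snd (p y))) = (if y = x then 1 else 0)" for y
    using assms(2)[of y] by (auto simp: tensor_coeff_M prod_eq_iff)
  then show ?thesis
    using assms(1) by (simp add: rat_linear_sum[OF tensor_coeff_linear])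
qed


section \<open>Maps that permute the monomial basis\<close>

lemma inj_M: "inj M"
proof (rule injI)
  fix \<alpha> \<beta> assume "M \<alpha> = M \<beta>"
  then have "M_coeff (M \<alpha>) \<beta> = M_coeff (M \<beta>) \<beta>" by simp
  then show "\<alpha> = \<beta>" by (simp add: M_coeff_M split: if_splits)
qed

lemma M_in_homogeneous:
  assumes "M \<alpha> \<in> qsym_homogeneous n"
  shows "comp_size \<alpha> = n"
proof (rule ccontr)
  assume n: "comp_size \<alpha> \<noteq> n"
  have lin: "rat_linear (\<lambda>f. M_coeff f \<alpha>)"
    by (rule rat_linearI) (simp_all add: M_coeff_add M_coeff_scaleQ scaleQ_rat_def)
  interpret C: Vector_Spaces.linear scaleQ scaleQ "\<lambda>f. M_coeff f \<alpha>" by (rule lin)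
  have "M_coeff f \<alpha> = 0" if "f \<in> {M \<beta> | \<beta>. comp_size \<beta> = n}" for f
    using that n by (auto simp: M_coeff_M)
  then have "M_coeff (M \<alpha>) \<alpha> = 0"
    by (rule C.eq_0_on_span) (use assms in \<open>simp_all add: qsym_homogeneous_def\<close>)
  then show False by (simp add: M_coeff_M)
qed

lemma basis_permutation_size:
  assumes "graded_map \<phi>" "\<And>\<alpha>. \<phi> (M \<alpha>) = M (\<sigma> \<alpha>)"
  shows "comp_size (\<sigma> \<alpha>) = comp_size \<alpha>"
proof -
  have "M \<alpha> \<in> qsym_homogeneous (comp_size \<alpha>)"
    unfolding qsym_homogeneous_def by (intro rat_vs.span_base) blast
  then have "M (\<sigma> \<alpha>) \<in> qsym_homogeneous (comp_size \<alpha>)"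
    using assms unfolding graded_map_def by (metis image_subset_iff)
  then show ?thesis by (rule M_in_homogeneous)
qed

text \<open>
  Both sides are the same coefficient, that of \<open>M (\<sigma> \<beta>) \<otimes> M (\<sigma> \<gamma>)\<close>, in the two
  expressions for \<open>\<Delta> (\<phi> (M \<alpha>))\<close>.
\<close>

lemma basis_permutation_concat_iff:
  assumes lin: "rat_linear \<phi>"
    and coprod: "\<And>f. coproduct (\<phi> f) = tensor_map \<phi> \<phi> (coproduct f)"
    and \<phi>: "\<And>\<alpha>. \<phi> (M \<alpha>) = M (\<sigma> \<alpha>)" and "inj \<sigma>"
  shows "\<sigma> \<alpha> = \<sigma> \<beta> \<cdot> \<sigma> \<gamma> \<longleftrightarrow> \<alpha> = \<beta> \<cdot> \<gamma>"
proof -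
  let ?D = "\<lambda>\<alpha>. {(\<beta>, \<gamma>). \<alpha> = \<beta> \<cdot> \<gamma>}"
  have "coproduct (M (\<sigma> \<alpha>)) = (\<Sum>y\<in>?D (\<sigma> \<alpha>). M (fst y) \<otimes> M (snd y))"
    by (simp add: coproduct_M case_prod_unfold)
  then have left: "tensor_coeff (\<sigma> \<beta>) (\<sigma> \<gamma>) (coproduct (M (\<sigma> \<alpha>))) = of_bool (\<sigma> \<alpha> = \<sigma> \<beta> \<cdot> \<sigma> \<gamma>)"
    using tensor_coeff_sum_M[of "?D (\<sigma> \<alpha>)" id "\<sigma> \<beta>" "\<sigma> \<gamma>" "(\<sigma> \<beta>, \<sigma> \<gamma>)"]
    by (simp add: finite_deconcatenations)
  have "tensor_map \<phi> \<phi> (coproduct (M \<alpha>))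
      = (\<Sum>y\<in>?D \<alpha>. M (fst (map_prod \<sigma> \<sigma> y)) \<otimes> M (snd (map_prod \<sigma> \<sigma> y)))"
    by (simp add: coproduct_M case_prod_unfold rat_linear_sum[OF tensor_map_linear[OF lin lin]]
        tensor_map_pure[OF lin lin] \<phi>)
  moreover have "map_prod \<sigma> \<sigma> y = (\<sigma> \<beta>, \<sigma> \<gamma>) \<longleftrightarrow> y = (\<beta>, \<gamma>)" for y
    using \<open>inj \<sigma>\<close> by (cases y) (simp add: inj_eq)
  ultimately have right: "tensor_coeff (\<sigma> \<beta>) (\<sigma> \<gamma>) (tensor_map \<phi> \<phi> (coproduct (M \<alpha>)))
      = of_bool (\<alpha> = \<beta> \<cdot> \<gamma>)"
    using tensor_coeff_sum_M[of "?D \<alpha>" "map_prod \<sigma> \<sigma>" "\<sigma> \<beta>" "\<sigma> \<gamma>" "(\<beta>, \<gamma>)"]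
    by (simp add: finite_deconcatenations)
  from left right show ?thesis
    using coprod[of "M \<alpha>"] by (simp add: \<phi> of_bool_eq_iff)
qed


section \<open>Automorphisms of the monoid of compositions\<close>

lemma composition_eqI: "parts \<alpha> = parts \<beta> \<Longrightarrow> \<alpha> = \<beta>"
  by (simp add: parts_inject)

lemma parts_Composition_single: "0 < n \<Longrightarrow> parts (Composition [n]) = [n]"
  by (rule Composition_inverse) simp

lemma composition_cases:
  obtains (empty) "\<alpha> = comp_empty"
  | (Cons) n \<beta> where "0 < n" "\<alpha> = Composition [n] \<cdot> \<beta>"
      "length (parts \<beta>) < length (parts \<alpha>)"
proof (cases "parts \<alpha>")
  case Nil
  then show ?thesis by (intro empty composition_eqI) (simp add: comp_empty.rep_eq)
next
  case (Cons n ns)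
  have pos: "\<forall>x\<in>set (n # ns). 0 < x" using parts[of \<alpha>] Cons by simp
  then have ns: "parts (Composition ns) = ns" by (intro Composition_inverse) simp
  show ?thesis
  proof (rule that(2))
    show "0 < n" using pos by simp
    then show "\<alpha> = Composition [n] \<cdot> Composition ns"
      by (intro composition_eqI) (simp add: comp_concat.rep_eq parts_Composition_single ns Cons)
    show "length (parts (Composition ns)) < length (parts \<alpha>)"
      by (simp add: ns Cons)
  qed
qed

text \<open>
  Split off the first part \<open>m\<close> of \<open>\<sigma> (n)\<close> and pull this factorization back along \<open>\<sigma>\<close>.  The
  one-part composition \<open>(n)\<close> has only trivial factorizations, and the factor that maps to
  \<open>(m)\<close> is nonempty, so it is \<open>(n)\<close> itself.  Then \<open>m = n\<close> by comparing sizes.  One-part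
  compositions are thus fixed, and all others are products of these.
\<close>

lemma size_preserving_concat_automorphism:
  assumes "surj \<sigma>"
    and concat: "\<And>\<alpha> \<beta> \<gamma>. \<sigma> \<alpha> = \<sigma> \<beta> \<cdot> \<sigma> \<gamma> \<longleftrightarrow> \<alpha> = \<beta> \<cdot> \<gamma>"
    and size: "\<And>\<alpha>. comp_size (\<sigma> \<alpha>) = comp_size \<alpha>"
  shows "\<sigma> \<alpha> = \<alpha>"
proof -
  have size_0: "\<alpha> = comp_empty" if "comp_size \<alpha> = 0" for \<alpha>
    using that parts[of \<alpha>]
    by (intro composition_eqI) (cases "parts \<alpha>"; simp add: comp_size.rep_eq comp_empty.rep_eq)
  have empty: "\<sigma> comp_empty = comp_empty"
    by (rule size_0, unfold size) (simp add: comp_size.rep_eq comp_empty.rep_eq)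
  have single: "\<sigma> (Composition [n]) = Composition [n]" if "0 < n" for n
  proof (cases "\<sigma> (Composition [n])" rule: composition_cases)
    case empty
    then have "n = 0"
      using size[of "Composition [n]"] that
      by (simp add: comp_size.rep_eq comp_empty.rep_eq parts_Composition_single)
    with that show ?thesis by simp
  next
    case (Cons m \<gamma>')
    obtain \<beta> \<gamma> where \<beta>\<gamma>: "\<sigma> \<beta> = Composition [m]" "\<sigma> \<gamma> = \<gamma>'"
      using \<open>surj \<sigma>\<close> by (metis surjD)
    with Cons have "Composition [n] = \<beta> \<cdot> \<gamma>" using concat by metis
    then have "[n] = parts \<beta> @ parts \<gamma>"
      using that by (metis comp_concat.rep_eq parts_Composition_single)
    moreover have "parts \<beta> \<noteq> []"
      using size[of \<beta>] \<beta>\<gamma>(1) \<open>0 < m\<close> by (auto simp: comp_size.rep_eq parts_Composition_single)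
    ultimately have \<gamma>: "parts \<beta> = [n]" "parts \<gamma> = []" by (auto simp: Cons_eq_append_conv)
    have "m = n"
      using size[of \<beta>] \<beta>\<gamma>(1) \<open>0 < m\<close> \<gamma>(1)
      by (simp add: comp_size.rep_eq parts_Composition_single)
    with \<gamma>(1) that have "\<beta> = Composition [n]"
      by (intro composition_eqI) (simp add: parts_Composition_single)
    with \<beta>\<gamma>(1) \<open>m = n\<close> show ?thesis by simp
  qed
  show ?thesis
  proof (induction "length (parts \<alpha>)" arbitrary: \<alpha> rule: less_induct)
    case less
    show ?case
    proof (cases \<alpha> rule: composition_cases)
      case (Cons n \<beta>)
      then have "\<sigma> \<alpha> = \<sigma> (Composition [n]) \<cdot> \<sigma> \<beta>" using concat by metis
      with Cons less show ?thesis by (simp add: single)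
    qed (simp add: empty)
  qed
qed


section \<open>Rigidity\<close>

theorem theorem4p7:
  fixes \<phi> :: "qsym \<Rightarrow> qsym"
  assumes "graded_hopf_automorphism \<phi>"
    and "\<phi> ` range M = range M"
  shows "\<phi> = id"
proof -
  have lin: "rat_linear \<phi>" and graded: "graded_map \<phi>" and "inj \<phi>"
    and coprod: "\<And>f. coproduct (\<phi> f) = tensor_map \<phi> \<phi> (coproduct f)"
    using assms(1) by (auto simp: graded_hopf_automorphism_def hopf_hom_def bij_def)
  have "\<forall>\<alpha>. \<exists>\<beta>. \<phi> (M \<alpha>) = M \<beta>" using assms(2) by blast
  then obtain \<sigma> where \<phi>: "\<And>\<alpha>. \<phi> (M \<alpha>) = M (\<sigma> \<alpha>)" by metis
  have "inj \<sigma>"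
    using \<open>inj \<phi>\<close> inj_M \<phi> by (metis injI injD)
  have "surj \<sigma>"
    unfolding surj_def
  proof
    fix \<beta>
    obtain \<alpha> where "M \<beta> = \<phi> (M \<alpha>)" using assms(2) by blast
    then show "\<exists>\<alpha>. \<beta> = \<sigma> \<alpha>" using inj_M by (auto simp: \<phi> inj_eq)
  qed
  then have "\<sigma> \<alpha> = \<alpha>" for \<alpha>
    by (rule size_preserving_concat_automorphism)
      (rule basis_permutation_concat_iff[OF lin coprod \<phi> \<open>inj \<sigma>\<close>]
        basis_permutation_size[OF graded \<phi>])+
  then have fix_M: "\<phi> (M \<alpha>) = M \<alpha>" for \<alpha> by (simp add: \<phi>)
  show ?thesis
  proof
    fix f
    have "\<phi> f = (\<Sum>\<alpha> | M_coeff f \<alpha> \<noteq> 0. M_coeff f \<alpha> *\<^sub>Q \<phi> (M \<alpha>))"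
      by (subst M_expansion) (simp only: rat_linear_sum[OF lin] rat_linearD(2)[OF lin])
    also have "\<dots> = f" unfolding fix_M by (rule M_expansion[symmetric])
    finally show "\<phi> f = id f" by simp
  qed
qed

end
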